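(* Let $s,a\geq 2$ be integers and let $G$ be a graph with fewer than $t(s,a-1)$ edges. Let $L_1,\dots,L_a\subseteq V(G)$ be sets of size $s$. Then there exist distinct vertices $u_1,\dots,u_a$ with $u_i\in L_i$ for each $i$ such that $\{u_1,\dots,u_a\}$ is an independent set in $G$.
   Context: For positive integers $s$ and $k$, $t(s,k)=\min\sum_{i=1}^{k}\binom{d_i}{2}$, where the minimum is taken over all sequences $(d_1,\dots,d_k)$ of non-negative integers with $\sum_{i=1}^k d_i=s$. *)

theory Defs
  imports "HOL-Library.Ramsey"
begin

definition tmin :: "nat \<Rightarrow> nat \<Rightarrow> nat" where
  "tmin s k = Min {(\<Sum>i=1..k. d i choose 2) | d :: nat \<Rightarrow> nat. (\<Sum>i=1..k. d i) = s}"

text \<open>The set in the definition of \<open>tmin\<close> is finite and, for \<open>k \<ge> 1\<close>, nonempty, so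
  \<^term>\<open>Min\<close> is a genuine minimum.\<close>

lemma finite_tmin_set:
  "finite {(\<Sum>i=1..k. d i choose 2) | d :: nat \<Rightarrow> nat. (\<Sum>i=1..k. d i) = s}"
proof (rule finite_subset)
  show "{(\<Sum>i=1..k. d i choose 2) | d :: nat \<Rightarrow> nat. (\<Sum>i=1..k. d i) = s} \<subseteq> {..k * (s choose 2)}"
  proof
    fix x
    assume "x \<in> {(\<Sum>i=1..k. d i choose 2) | d :: nat \<Rightarrow> nat. (\<Sum>i=1..k. d i) = s}"
    then obtain d :: "nat \<Rightarrow> nat" where x: "x = (\<Sum>i=1..k. d i choose 2)" and s: "(\<Sum>i=1..k. d i) = s"
      by blast
    have "d i \<le> s" if "i \<in> {1..k}" for i
      unfolding s[symmetric] using that by (intro member_le_sum) auto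
    then have "x \<le> (\<Sum>i=1..k. s choose 2)"
      unfolding x by (intro sum_mono binomial_right_mono) auto
    then show "x \<in> {..k * (s choose 2)}"
      by simp
  qed
qed simp

lemma tmin_set_nonempty:
  assumes "k \<ge> 1"
  shows "{(\<Sum>i=1..k. d i choose 2) | d :: nat \<Rightarrow> nat. (\<Sum>i=1..k. d i) = s} \<noteq> {}"
proof -
  have "(\<Sum>i=1..k. if i = 1 then s else 0) = s"
    using assms by (simp add: sum.delta)
  then show ?thesis by blast
qed

end

theory Submission
  imports Defs
begin

text \<open>Greedy choice, as in the proof of Turan's theorem that removes a vertex of minimum degree. In
  the subgraph induced by the union of the lists take a vertex \<open>v\<close> of minimum degree \<open>d - 1\<close>, let it
  represent a list that contains it, and delete its closed neighbourhood, which has \<open>d\<close> elements,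
  from the other lists. All vertices of the neighbourhood have degree at least \<open>d - 1\<close>, so at least
  \<open>d choose 2\<close> edges disappear, while the lists shrink by at most \<open>d\<close>. Since
  \<open>t(s, k + 1) \<le> (d choose 2) + t(s - d, k)\<close>, the argument can be iterated.\<close>

lemma tmin_le: "(\<Sum>i=1..k. d i) = s \<Longrightarrow> tmin s k \<le> (\<Sum>i=1..k. d i choose 2)"
  unfolding tmin_def by (rule Min_le[OF finite_tmin_set]) blast

lemma tmin_attained:
  assumes "k \<ge> 1"
  obtains d where "(\<Sum>i=1..k. d i) = s" "tmin s k = (\<Sum>i=1..k. d i choose 2)"
  using Min_in[OF finite_tmin_set tmin_set_nonempty[OF assms], where s1 = s]
  unfolding tmin_def by auto

text \<open>Put all of \<open>s\<close> into one part. This bound later keeps the deleted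
  neighbourhood smaller than the lists.\<close>

lemma tmin_le_choose:
  assumes "k \<ge> 1"
  shows "tmin s k \<le> s choose 2"
proof -
  have "(\<Sum>i=1..k. if i = 1 then s else 0) = s"
    using assms by (simp add: sum.delta)
  note tmin_le[OF this]
  also have "(\<Sum>i=1..k. (if i = 1 then s else 0) choose 2) = (\<Sum>i=1..k. if i = 1 then s choose 2 else 0)"
    by (rule sum.cong) auto
  also have "\<dots> = s choose 2"
    using assms by (simp add: sum.delta)
  finally show ?thesis .
qed

text \<open>Append \<open>d\<close> as a further part to an optimal sequence for
  \<open>s - d\<close>.\<close>

lemma tmin_Suc_le:
  assumes "k \<ge> 1" "d \<le> s"
  shows "tmin s (Suc k) \<le> (d choose 2) + tmin (s - d) k"
proof -
  obtain f where f: "(\<Sum>i=1..k. f i) = s - d" "tmin (s - d) k = (\<Sum>i=1..k. f i choose 2)"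
    using tmin_attained[OF assms(1)] .
  let ?g = "f(Suc k := d)"
  have "(\<Sum>i=1..k. ?g i) = (\<Sum>i=1..k. f i)" "(\<Sum>i=1..k. ?g i choose 2) = (\<Sum>i=1..k. f i choose 2)"
    by (auto intro!: sum.cong)
  then show ?thesis
    using tmin_le[of ?g "Suc k" s] f assms(2) by simp
qed

text \<open>Double count incidences between \<open>C\<close> and the edges meeting it: the degrees
  in \<open>C\<close> sum to at least \<open>card C * (card C - 1)\<close>, and each edge has at
  most two ends in \<open>C\<close>.\<close>

lemma choose_two_le_card_edges_meeting:
  fixes E :: "'a set set"
  assumes "finite E" "\<And>e. e \<in> E \<Longrightarrow> card e = 2" "finite C"
    and deg: "\<And>w. w \<in> C \<Longrightarrow> card C - 1 \<le> card {e \<in> E. w \<in> e}"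
  shows "card C choose 2 \<le> card {e \<in> E. e \<inter> C \<noteq> {}}"
proof -
  let ?F = "{e \<in> E. e \<inter> C \<noteq> {}}"
  have "card C * (card C - 1) \<le> (\<Sum>w\<in>C. card {e \<in> E. w \<in> e})"
    using sum_mono[of C "\<lambda>_. card C - 1", OF deg] by simp
  also have "\<dots> = (\<Sum>w\<in>C. card {e \<in> ?F. w \<in> e})"
    by (intro sum.cong refl arg_cong[where f = card]) auto
  also have "\<dots> = (\<Sum>e\<in>?F. card {w \<in> C. w \<in> e})"
    using sum_multicount_gen[of C ?F "\<lambda>w e. w \<in> e" "\<lambda>e. card {w \<in> C. w \<in> e}"] assms(1,3) by simp
  also have "\<dots> \<le> (\<Sum>e\<in>?F. 2)"
  proof (rule sum_mono)
    fix e assume "e \<in> ?F"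
    then have "card e = 2"
      using assms(2) by simp
    moreover from this have "finite e"
      by (metis card.infinite zero_neq_numeral)
    ultimately show "card {w \<in> C. w \<in> e} \<le> 2"
      using card_mono[of e "{w \<in> C. w \<in> e}"] by auto
  qed
  finally show ?thesis
    by (simp add: choose_two)
qed

lemma card_neighbours_eq_degree:
  assumes "\<And>e. e \<in> E \<Longrightarrow> card e = 2"
  shows "card {w. {v, w} \<in> E} = card {e \<in> E. v \<in> e}"
proof (rule bij_betw_same_card)
  have "{e \<in> E. v \<in> e} \<subseteq> (\<lambda>w. {v, w}) ` {w. {v, w} \<in> E}"
  proof
    fix e assume e: "e \<in> {e \<in> E. v \<in> e}"
    then obtain x y where "e = {x, y}"
      using assms[of e] by (auto simp: card_2_iff)
    with e show "e \<in> (\<lambda>w. {v, w}) ` {w. {v, w} \<in> E}"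
      by (auto simp: insert_commute)
  qed
  then show "bij_betw (\<lambda>w. {v, w}) {w. {v, w} \<in> E} {e \<in> E. v \<in> e}"
    by (auto simp: bij_betw_def inj_on_def doubleton_eq_iff)
qed

text \<open>For \<open>k = 0\<close> the value \<open>tmin s 0\<close> is a junk \<open>Min {}\<close>, hence the guard on the edge bound.\<close>

lemma independent_representatives:
  fixes E :: "'a set set" and L :: "'i \<Rightarrow> 'a set"
  assumes "finite I" "card I = Suc k" "s \<ge> 1" "finite E" "\<And>e. e \<in> E \<Longrightarrow> card e = 2"
    and "k \<ge> 1 \<Longrightarrow> card E < tmin s k"
    and "\<And>i. i \<in> I \<Longrightarrow> finite (L i) \<and> s \<le> card (L i)"
  shows "\<exists>u. (\<forall>i\<in>I. u i \<in> L i) \<and> inj_on u I \<and> indep (u ` I) E"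
  using assms
proof (induction k arbitrary: I s E L)
  case 0
  then obtain i where I: "I = {i}"
    by (auto simp: card_1_singleton_iff)
  with 0 have "L i \<noteq> {}"
    by force
  then obtain x where "x \<in> L i"
    by blast
  then show ?case
    unfolding I by (intro exI[of _ "\<lambda>_. x"]) (auto simp: indep_def)
next
  case (Suc k)
  define U where "U = (\<Union>i\<in>I. L i)"
  \<comment> \<open>Degrees are taken inside \<open>U\<close>, so that neighbours of
    \<open>v\<close> stay in \<open>U\<close> and are covered by the minimality of
    \<open>deg v\<close>.\<close>
  define H where "H = {e \<in> E. e \<subseteq> U}"
  define deg where "deg w = card {e \<in> H. w \<in> e}" for w
  have finU: "finite U"
    using Suc.prems unfolding U_def by auto
  have finH: "finite H" and H2: "\<And>e. e \<in> H \<Longrightarrow> card e = 2"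
    using Suc.prems unfolding H_def by auto
  obtain i where "i \<in> I"
    using Suc.prems(2) by fastforce
  then have "U \<noteq> {}"
    using Suc.prems(3) Suc.prems(7)[of i] unfolding U_def by force
  then obtain v where v: "v \<in> U" and v_min: "\<And>w. w \<in> U \<Longrightarrow> deg v \<le> deg w"
    using finU by (metis arg_min_least arg_min_if_finite(1))
  obtain j where j: "j \<in> I" "v \<in> L j"
    using v unfolding U_def by blast
  define N where "N = {w. {v, w} \<in> H}"
  define C where "C = insert v N"
  define F where "F = {e \<in> H. e \<inter> C \<noteq> {}}"
  have CU: "C \<subseteq> U"
    using v unfolding C_def N_def H_def by auto
  then have finC: "finite C"
    using finU finite_subset by blast
  have "v \<notin> N"
    using H2[of "{v, v}"] unfolding N_def by auto
  moreover have "card N = deg v"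
    unfolding N_def deg_def by (rule card_neighbours_eq_degree[OF H2])
  ultimately have cardC: "card C = Suc (deg v)"
    using finC unfolding C_def by simp
  have F: "card C choose 2 \<le> card F"
    unfolding F_def
  proof (rule choose_two_le_card_edges_meeting[OF finH H2 finC])
    show "card C - 1 \<le> card {e \<in> H. w \<in> e}" if "w \<in> C" for w
      using v_min[of w] CU that cardC unfolding deg_def by auto
  qed
  have FE: "F \<subseteq> E"
    unfolding F_def H_def by auto
  then have "card F \<le> card E"
    using Suc.prems(4) by (rule card_mono[rotated])
  \<comment> \<open>If \<open>card C\<close> were at least \<open>s\<close>, the edges meeting
    \<open>C\<close> alone would exceed the edge bound. So the trimmed lists keep at least
    \<open>s - card C\<close>, hence at least 1, elements.\<close>
  with F Suc.prems(6) tmin_le_choose[of "Suc k" s] have "card C choose 2 < s choose 2"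
    by simp
  then have Cs: "card C < s"
    by (metis binomial_right_mono not_le)
  define J where "J = I - {j}"
  \<comment> \<open>Dropping \<open>j\<close> leaves an arbitrary index set, and the lists may lose
    different numbers of vertices; hence an induction over any finite \<open>I\<close> with only a
    lower bound on list sizes.\<close>
  have "\<exists>u. (\<forall>i\<in>J. u i \<in> L i - C) \<and> inj_on u J \<and> indep (u ` J) (E - F)"
  proof (rule Suc.IH)
    show "finite J" "card J = Suc k"
      using Suc.prems(1,2) j unfolding J_def by auto
    show "1 \<le> s - card C" "finite (E - F)" "\<And>e. e \<in> E - F \<Longrightarrow> card e = 2"
      using Cs Suc.prems(4,5) by auto
    show "card (E - F) < tmin (s - card C) k" if "k \<ge> 1"
    proof -
      have "card (E - F) + card F = card E"
        using FE Suc.prems(4) \<open>card F \<le> card E\<close> by (simp add: card_Diff_subset finite_subset)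
      then show ?thesis
        using Suc.prems(6) tmin_Suc_le[OF that, of "card C" s] Cs F by simp
    qed
    show "finite (L i - C) \<and> s - card C \<le> card (L i - C)" if "i \<in> J" for i
      using Suc.prems(7)[of i] that diff_card_le_card_Diff[OF finC, of "L i"] unfolding J_def by auto
  qed
  then obtain u where uL: "\<And>i. i \<in> J \<Longrightarrow> u i \<in> L i - C" and inj: "inj_on u J"
    and indep: "indep (u ` J) (E - F)"
    by blast
  have I: "I = insert j J" "j \<notin> J"
    using j unfolding J_def by auto
  have uU: "u i \<in> U" if "i \<in> J" for i
    using uL[OF that] that unfolding U_def I by blast
  \<comment> \<open>Both ends lie in \<open>U\<close>, so an edge of \<open>E\<close> between them
    would be in \<open>H\<close> and put \<open>u i\<close> into \<open>N\<close>.\<close>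
  have v_nonadj: "{v, u i} \<notin> E" if "i \<in> J" for i
    using uL[OF that] uU[OF that] v unfolding C_def N_def H_def by auto
  have u_nonadj: "{u i, u i'} \<notin> E" if "i \<in> J" "i' \<in> J" "u i \<noteq> u i'" for i i'
  proof -
    \<comment> \<open>Edges of \<open>F\<close> meet \<open>C\<close>, which the representatives
      from \<open>J\<close> avoid; restoring \<open>F\<close> therefore does no harm.\<close>
    have "{u i, u i'} \<notin> F"
      using uL that unfolding F_def by auto
    moreover have "{u i, u i'} \<notin> E - F"
      using indep that unfolding indep_def by auto
    ultimately show ?thesis
      by blast
  qed
  let ?u = "u(j := v)"
  have img: "?u ` I = insert v (u ` J)"
    using I by auto
  have "\<forall>i\<in>I. ?u i \<in> L i"
    using uL j unfolding I by auto
  moreover have "inj_on ?u I"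
  proof -
    have "v \<notin> u ` J"
      using uL unfolding C_def by auto
    then show ?thesis
      using inj I by (auto simp: inj_on_def)
  qed
  moreover have "indep (?u ` I) E"
    unfolding img indep_def using v_nonadj u_nonadj by (auto simp: insert_commute)
  ultimately show ?case
    by blast
qed

theorem theorem6p2:
  fixes s a :: nat and V :: "'a set" and E :: "'a set set" and L :: "nat \<Rightarrow> 'a set"
  assumes "s \<ge> 2" and "a \<ge> 2"
    and "E \<subseteq> [V]\<^bsup>2\<^esup>" and "finite E" and "card E < tmin s (a - 1)"
    and "\<And>i. i \<in> {1..a} \<Longrightarrow> L i \<subseteq> V \<and> card (L i) = s"
  shows "\<exists>u. (\<forall>i\<in>{1..a}. u i \<in> L i) \<and> inj_on u {1..a} \<and> indep (u ` {1..a}) E"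
proof (rule independent_representatives)
  show "card {1..a} = Suc (a - 1)" "1 \<le> s"
    using assms(1,2) by auto
  show "card e = 2" if "e \<in> E" for e
    using that assms(3) unfolding nsets_def by auto
  \<comment> \<open>\<open>V\<close> may be infinite, but \<open>card\<close> is 0 on infinite sets,
    so the positive size \<open>s\<close> makes each list finite.\<close>
  show "finite (L i) \<and> s \<le> card (L i)" if "i \<in> {1..a}" for i
    using assms(6)[OF that] assms(1) by (auto intro: card_ge_0_finite)
qed (use assms(4,5) in auto)

end
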